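(* Let $n\in\mathbb{N}$, let $f=(f_1,\dots,f_n)\in\mathcal{B}^n$, and let $V\subset\mathbb{R}^n$ be finite. Then there exists a Borel measurable set $G=G^1\times\cdots\times G^n\subset\mathbb{R}^n$ with $0\in G$ and $G^k_{|\cdot|}=\{|x|:x\in G^k\}$ closed for $k=1,\dots,n$, such that $$\sup_{X\in\mathcal{T}(f)}P(X\in V)=P\big(\mathscr{S}(f,G)\in V\big)$$ and $$G=\big(\pi_1(G\cap V)\cup\{0\}\big)\times\cdots\times\big(\pi_n(G\cap V)\cup\{0\}\big),$$ where $\pi_k:\mathbb{R}^n\to\mathbb{R}$ is the projection on the $k$th coordinate.
   Context: $(0,1)^n$ carries Lebesgue measure on the Borel $\sigma$-algebra, which is the probability measure $P$ for random variables with domain $(0,1)^n$. A real random variable is neat if it is a monotonically increasing (nondecreasing) function $(0,1)\to\mathbb{R}$. $\mathcal{N}^n$ is the set of product random variables $X:(0,1)^n\to\mathbb{R}^n$, $X(s_1,\dots,s_n)=(X_1(s_1),\dots,X_n(s_n))$, with each $X_k$ neat (so the components are mutually independent). $\mathcal{B}$ is the set of functions $f:[0,\infty)\to[0,1]$ with $f(0)=1$, $f$ nonincreasing with limit $0$ at $\infty$, and $f$ left continuous; such $f$ is extended by $f(t)=1$ for $t<0$. For $f\in\mathcal{B}^n$, $\mathcal{T}(f)=\{X\in\mathcal{N}^n : P(|X_k|\ge t)\le f_k(t)\ \forall t\ge0,\ k=1,\dots,n\}$. For $A\subset\mathbb{R}$ write $A_{|\cdot|}=\{|x|:x\in A\}$.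 Let $f\in\mathcal{B}^n$ and $0\in G=G^1\times\cdots\times G^n\subset\mathbb{R}^n$ with each $G^k$ Borel measurable and each $G^k_{|\cdot|}$ closed. The absolute shift operator returns $\mathscr{S}(f,G)=(X_1,\dots,X_n):(0,1)^n\to\mathbb{R}^n$, the product random variable $(s_1,\dots,s_n)\mapsto(X_1(s_1),\dots,X_n(s_n))$, where, with $\widetilde{X}_k(s)=\sup f_k^{-1}[1-s,1]$ and $r_k(s)=\sup\{u\in G^k_{|\cdot|}\cup(-\infty,\inf G^k_{|\cdot|}] : u\le\widetilde{X}_k(s)\}$, $$X_k(s)=\begin{cases} r_k(s), & \text{if } r_k(s)\in G^k\cap[0,\infty),\\ -r_k(s), & \text{otherwise,}\end{cases}\qquad s\in(0,1).$$ *)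

theory Defs
  imports "HOL-Probability.Probability"
begin

definition unit_cube :: "(real ^ 'n::finite) set" where
  "unit_cube = {s. \<forall>k. 0 < s $ k \<and> s $ k < 1}"

definition cube_measure :: "(real ^ 'n::finite) measure" where
  "cube_measure = restrict_space lborel unit_cube"

lemma unit_cube_eq_box: "unit_cube = box 0 (1 :: real ^ 'n::finite)"
  by (auto simp: unit_cube_def box_def Basis_vec_def inner_axis)

lemma prob_space_cube_measure: "prob_space (cube_measure :: (real ^ 'n::finite) measure)"
proof
  have "inner (1 :: real ^ 'n) b = 1" if "b \<in> Basis" for b :: "real ^ 'n"
    using that by (auto simp: Basis_vec_def inner_axis)
  then show "emeasure (cube_measure :: (real ^ 'n) measure) (space cube_measure) = 1"
    by (simp add: cube_measure_def emeasure_restrict_space space_restrict_space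
        unit_cube_eq_box emeasure_lborel_box_eq)
qed

text \<open>Random variables have domain \<open>(0,1)\<^sup>n\<close>, respectively \<open>(0,1)\<close>; they are represented by total
  functions whose values outside that domain play no role.\<close>

definition neat :: "(real \<Rightarrow> real) \<Rightarrow> bool" where
  "neat Y \<longleftrightarrow> mono_on {0<..<1} Y"

definition neat_products :: "((real ^ 'n::finite) \<Rightarrow> real ^ 'n) set" where
  "neat_products = {X. \<exists>Y. (\<forall>k. neat (Y k)) \<and> (\<forall>s\<in>unit_cube. X s = (\<chi> k. Y k (s $ k)))}"

text \<open>An element of \<open>\<B>\<close> is a function on \<open>[0,\<infty>)\<close>; here it comes together with its extension
  by \<open>1\<close> to the negative reals.\<close>

definition tail_bounds :: "(real \<Rightarrow> real) set" where
  "tail_bounds = {f. (\<forall>t<0. f t = 1) \<and> f 0 = 1 \<and> (\<forall>t\<ge>0. f t \<in> {0..1}) \<and>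
     antimono_on {0..} f \<and> (f \<longlongrightarrow> 0) at_top \<and> (\<forall>t>0. continuous (at_left t) f)}"

definition tail_class :: "('n::finite \<Rightarrow> real \<Rightarrow> real) \<Rightarrow> ((real ^ 'n) \<Rightarrow> real ^ 'n) set" where
  "tail_class f = {X \<in> neat_products.
     \<forall>t\<ge>0. \<forall>k. measure cube_measure {s \<in> unit_cube. \<bar>X s $ k\<bar> \<ge> t} \<le> f k t}"

definition product_set :: "('n::finite \<Rightarrow> real set) \<Rightarrow> (real ^ 'n) set" where
  "product_set H = {x. \<forall>k. x $ k \<in> H k}"

definition shift_tilde :: "(real \<Rightarrow> real) \<Rightarrow> real \<Rightarrow> real" where
  "shift_tilde g s = Sup (g -` {1 - s..1})"

definition shift_radius :: "(real \<Rightarrow> real) \<Rightarrow> real set \<Rightarrow> real \<Rightarrow> real" where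
  "shift_radius g A s = Sup {u \<in> abs ` A \<union> {..Inf (abs ` A)}. u \<le> shift_tilde g s}"

definition shift_component :: "(real \<Rightarrow> real) \<Rightarrow> real set \<Rightarrow> real \<Rightarrow> real" where
  "shift_component g A s =
     (if shift_radius g A s \<in> A \<inter> {0..} then shift_radius g A s else - shift_radius g A s)"

text \<open>The set \<open>G\<close> enters through its factors \<open>H\<close>, \<open>G = product_set H\<close>; they are determined
  by \<open>G\<close> since \<open>0 \<in> G\<close>.\<close>

definition absolute_shift ::
  "('n::finite \<Rightarrow> real \<Rightarrow> real) \<Rightarrow> ('n \<Rightarrow> real set) \<Rightarrow> (real ^ 'n) \<Rightarrow> real ^ 'n" where
  "absolute_shift f H s = (\<chi> k. shift_component (f k) (H k) (s $ k))"

end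

theory Submission
  imports Defs
begin

text \<open>The probability \<open>P(X \<in> V)\<close> is linear in the law of each component \<open>X\<^sub>k\<close>, a nonnegative weight
  \<open>c\<close> of finite support being integrated. With \<open>M(t)\<close> the maximum of \<open>c\<close> over the points of absolute
  value at most \<open>t\<close>, we have \<open>c(X\<^sub>k) \<le> M(\<bar>X\<^sub>k\<bar>)\<close>, and \<open>\<bar>X\<^sub>k\<bar>\<close> is stochastically dominated by the
  variable with tail \<open>f\<^sub>k\<close>. Shifting that variable to the record points, where \<open>c(x) = M(\<bar>x\<bar>)\<close>, turns
  both estimates into equalities. So components may be replaced by shifts one at a time, and the
  supremum is a maximum over the finitely many products of subsets of the projections of \<open>V\<close>.
  In a maximiser of least total cardinality every nonzero coordinate is that of a point of
  \<open>G \<inter> V\<close>, since deleting any other one does not decrease the probability.\<close>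

section \<open>Laws of product random variables on the cube\<close>

definition unit_interval :: "real measure" where
  "unit_interval = restrict_space lborel {0<..<1}"

text \<open>The atoms of the law of \<open>Y\<close>. As V is finite, nothing else of the law enters
  \<open>P(X \<in> V)\<close>.\<close>

definition point_mass :: "(real \<Rightarrow> real) \<Rightarrow> real \<Rightarrow> real" where
  "point_mass Y x = measure unit_interval {s \<in> {0<..<1}. Y s = x}"

lemma space_unit_interval [simp]: "space unit_interval = {0<..<1}"
  by (simp add: unit_interval_def space_restrict_space)

lemma prob_space_unit_interval: "prob_space unit_interval"
  by (auto simp: unit_interval_def emeasure_restrict_space space_restrict_space
      intro!: prob_spaceI)

interpretation unit_interval: prob_space unit_interval
  by (rule prob_space_unit_interval)

lemma mono_on_unit_interval_measurable:
  fixes Y :: "real \<Rightarrow> real"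
  assumes "mono_on {0<..<1} Y"
  shows "Y \<in> borel_measurable unit_interval"
proof -
  have "Y \<in> borel_measurable (restrict_space borel {0<..<1})"
    by (rule borel_measurable_mono_on_fnc[OF assms])
  then show ?thesis
    by (simp add: unit_interval_def cong: measurable_cong_sets sets_restrict_space_cong)
qed

lemma unit_interval_borel_iff:
  assumes "A \<subseteq> {0<..<1}"
  shows "A \<in> sets unit_interval \<longleftrightarrow> A \<in> sets borel"
  using assms by (subst unit_interval_def, subst sets_restrict_space_iff) auto

lemma emeasure_unit_interval:
  assumes "A \<subseteq> {0<..<1}"
  shows "emeasure unit_interval A = emeasure lborel A"
  using assms by (simp add: unit_interval_def emeasure_restrict_space)

text \<open>Independence of the coordinates. The cube carries a restriction of \<open>lborel\<close>
  rather than a product of measures, so the factorisation comes from integrating a product over the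
  basis vectors.\<close>

lemma cube_measure_box:
  fixes A :: "'n::finite \<Rightarrow> real set"
  assumes sets: "\<And>k. A k \<in> sets unit_interval"
  shows "{s. \<forall>k. s $ k \<in> A k} \<in> sets cube_measure"
    and "measure cube_measure {s. \<forall>k. s $ k \<in> A k} = (\<Prod>k\<in>UNIV. measure unit_interval (A k))"
proof -
  have sub: "A k \<subseteq> {0<..<1}" for k
    using sets.sets_into_space[OF sets] by simp
  have bor [measurable]: "A k \<in> sets borel" for k
    using sets sub unit_interval_borel_iff by blast
  have cube: "unit_cube \<in> sets (lborel :: (real ^ 'n) measure)"
    by (simp add: unit_cube_eq_box)
  let ?B = "{s :: real ^ 'n. \<forall>k. s $ k \<in> A k}"
  have subB: "?B \<subseteq> unit_cube"
    using sub by (fastforce simp: unit_cube_def)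
  have B [measurable]: "?B \<in> sets borel"
    by measurable
  then show "?B \<in> sets cube_measure"
    using subB cube by (simp add: cube_measure_def sets_restrict_space_iff)
  have ax: "inj (\<lambda>k::'n. axis k (1::real))" "Basis = range (\<lambda>k::'n. axis k (1::real))"
    by (auto simp: inj_on_def axis_eq_axis Basis_vec_def)
  \<comment> \<open>The integration rule indexes its factors by basis vectors; \<open>h\<close>
    carries each side \<open>A k\<close> over to \<open>axis k 1\<close>.\<close>
  define h where "h b = (indicator (A (inv (\<lambda>k. axis k 1) b)) :: real \<Rightarrow> ennreal)" for b :: "real ^ 'n"
  have h: "h (axis k 1) = indicator (A k)" for k
    using inv_f_f[OF ax(1)] by (simp add: h_def)
  have "emeasure lborel ?B = (\<integral>\<^sup>+s. indicator ?B s \<partial>lborel)"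
    by simp
  also have "\<dots> = (\<integral>\<^sup>+s. (\<Prod>b\<in>Basis. h b (s \<bullet> b)) \<partial>lborel)"
  proof (rule nn_integral_cong)
    fix s :: "real ^ 'n"
    have "(\<Prod>b\<in>Basis. h b (s \<bullet> b)) = (\<Prod>k\<in>UNIV. indicator (A k) (s $ k))"
      unfolding ax(2) using ax(1) by (simp add: prod.reindex h inner_axis)
    then show "indicator ?B s = (\<Prod>b\<in>Basis. h b (s \<bullet> b))"
      by (auto simp: indicator_def)
  qed
  also have "\<dots> = (\<Prod>b\<in>Basis. (\<integral>\<^sup>+x. h b x \<partial>lborel))"
    by (rule nn_integral_lborel_prod) (auto simp: h_def)
  also have "\<dots> = (\<Prod>k\<in>UNIV. emeasure unit_interval (A k))"
    unfolding ax(2) using ax(1) by (simp add: prod.reindex h emeasure_unit_interval sub)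
  also have "\<dots> = ennreal (\<Prod>k\<in>UNIV. measure unit_interval (A k))"
    by (simp add: unit_interval.emeasure_eq_measure prod_ennreal)
  finally have "emeasure lborel ?B = ennreal (\<Prod>k\<in>UNIV. measure unit_interval (A k))" .
  then have "measure lborel ?B = (\<Prod>k\<in>UNIV. measure unit_interval (A k))"
    by (simp add: measure_def prod_nonneg)
  then show "measure cube_measure ?B = (\<Prod>k\<in>UNIV. measure unit_interval (A k))"
    using subB cube by (simp add: cube_measure_def measure_restrict_space)
qed

text \<open>The event splits into the disjoint boxes on which X takes one given value v in V, and
  each box factors over the coordinates.\<close>

lemma product_prob_finite:
  fixes Y :: "'n::finite \<Rightarrow> real \<Rightarrow> real" and V :: "(real ^ 'n) set"
  assumes [measurable]: "\<And>k. Y k \<in> borel_measurable unit_interval"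
    and X: "\<forall>s\<in>unit_cube. X s = (\<chi> k. Y k (s $ k))" and "finite V"
  shows "{s \<in> unit_cube. X s \<in> V} \<in> sets cube_measure"
    and "measure cube_measure {s \<in> unit_cube. X s \<in> V} =
      (\<Sum>v\<in>V. \<Prod>k\<in>UNIV. point_mass (Y k) (v $ k))"
proof -
  interpret cube: prob_space "cube_measure :: (real ^ 'n) measure"
    by (rule prob_space_cube_measure)
  define S where "S v k = {u \<in> {0<..<1}. Y k u = v $ k}" for v :: "real ^ 'n" and k
  have S: "S v k \<in> sets unit_interval" for v k
  proof -
    have "{u \<in> space unit_interval. Y k u = v $ k} \<in> sets unit_interval"
      by measurable
    then show ?thesis by (simp add: S_def)
  qed
  have box: "{s. \<forall>k. s $ k \<in> S v k} \<in> sets cube_measure"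
    "measure cube_measure {s. \<forall>k. s $ k \<in> S v k} = (\<Prod>k\<in>UNIV. measure unit_interval (S v k))" for v
    using cube_measure_box[of "S v"] S by blast+
  have eq: "{s \<in> unit_cube. X s \<in> V} = (\<Union>v\<in>V. {s. \<forall>k. s $ k \<in> S v k})"
  proof (rule set_eqI)
    fix s :: "real ^ 'n"
    show "s \<in> {s \<in> unit_cube. X s \<in> V} \<longleftrightarrow> s \<in> (\<Union>v\<in>V. {s. \<forall>k. s $ k \<in> S v k})"
    proof (cases "s \<in> unit_cube")
      case True
      then have "(\<forall>k. s $ k \<in> S v k) \<longleftrightarrow> X s = v" for v
        using X by (simp add: S_def unit_cube_def vec_eq_iff)
      then show ?thesis using True by auto
    next
      case False
      then show ?thesis by (auto simp: S_def unit_cube_def)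
    qed
  qed
  show "{s \<in> unit_cube. X s \<in> V} \<in> sets cube_measure"
    unfolding eq by (intro sets.finite_UN[OF \<open>finite V\<close>] box(1))
  have "measure cube_measure {s \<in> unit_cube. X s \<in> V} =
      (\<Sum>v\<in>V. measure cube_measure {s. \<forall>k. s $ k \<in> S v k})"
    unfolding eq
  proof (rule cube.finite_measure_finite_Union[OF \<open>finite V\<close>])
    show "(\<lambda>v. {s. \<forall>k. s $ k \<in> S v k}) ` V \<subseteq> sets cube_measure"
      using box(1) by blast
    show "disjoint_family_on (\<lambda>v. {s. \<forall>k. s $ k \<in> S v k}) V"
      unfolding disjoint_family_on_def
    proof (intro ballI impI)
      fix v w :: "real ^ 'n" assume "v \<noteq> w"
      then obtain k where "v $ k \<noteq> w $ k" by (auto simp: vec_eq_iff)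
      then have "S v k \<inter> S w k = {}" by (auto simp: S_def)
      then show "{s. \<forall>k. s $ k \<in> S v k} \<inter> {s. \<forall>k. s $ k \<in> S w k} = {}" by blast
    qed
  qed
  then show "measure cube_measure {s \<in> unit_cube. X s \<in> V} =
      (\<Sum>v\<in>V. \<Prod>k\<in>UNIV. point_mass (Y k) (v $ k))"
    by (simp add: box(2)) (simp add: S_def point_mass_def)
qed

text \<open>The event is a box whose other sides are all of (0,1). This turns the tail condition on
  the cube into one on each component separately.\<close>

lemma product_prob_component:
  fixes Y :: "'n::finite \<Rightarrow> real \<Rightarrow> real"
  assumes [measurable]: "\<And>k. Y k \<in> borel_measurable unit_interval"
    and X: "\<forall>s\<in>unit_cube. X s = (\<chi> k. Y k (s $ k))"
  shows "measure cube_measure {s \<in> unit_cube. \<bar>X s $ j\<bar> \<ge> t} =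
    measure unit_interval {u \<in> {0<..<1}. \<bar>Y j u\<bar> \<ge> t}"
proof -
  define S where "S k = (if k = j then {u \<in> {0<..<1}. \<bar>Y j u\<bar> \<ge> t} else {0<..<1})" for k
  have S: "S k \<in> sets unit_interval" for k
  proof -
    have "{u \<in> space unit_interval. \<bar>Y j u\<bar> \<ge> t} \<in> sets unit_interval" "space unit_interval \<in> sets unit_interval"
      by measurable
    then show ?thesis by (simp add: S_def)
  qed
  have eq: "{s \<in> unit_cube. \<bar>X s $ j\<bar> \<ge> t} = {s. \<forall>k. s $ k \<in> S k}"
    using X by (auto simp: S_def unit_cube_def split: if_splits)
  have "measure unit_interval (S k) =
      (if k = j then measure unit_interval {u \<in> {0<..<1}. \<bar>Y j u\<bar> \<ge> t} else 1)" for k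
    using unit_interval.prob_space by (simp add: S_def)
  then show ?thesis
    unfolding eq cube_measure_box(2)[OF S] by (simp add: prod.delta)
qed

section \<open>Expectations of weights and of their envelopes\<close>

text \<open>This writes the envelope \<open>M\<close> as a positive combination of tail indicators, which reduces
  stochastic dominance to the tail bounds.\<close>

lemma envelope_decomposition:
  fixes c :: "real \<Rightarrow> real"
  assumes "finite W"
  shows "\<exists>d. (\<forall>x. 0 \<le> d x) \<and>
    (\<forall>t. Max (insert 0 (c ` {x\<in>W. \<bar>x\<bar> \<le> t})) = (\<Sum>x\<in>W. d x * (if \<bar>x\<bar> \<le> t then 1 else 0)))"
  using assms
proof (induction W rule: finite_ranking_induct[where f = abs])
  case empty
  show ?case by (intro exI[of _ "\<lambda>_. 0"]) auto
next
  case (insert x S)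
  show ?case
  proof (cases "x \<in> S")
    case True
    then show ?thesis using insert.IH by (simp add: insert_absorb)
  next
    case False
    obtain d where d: "\<forall>x. 0 \<le> d x"
      "\<And>t. Max (insert 0 (c ` {x\<in>S. \<bar>x\<bar> \<le> t})) = (\<Sum>x\<in>S. d x * (if \<bar>x\<bar> \<le> t then 1 else 0))"
      using insert.IH by blast
    \<comment> \<open>Points are added in order of absolute value, so x is at least as far from 0 as
      all of S. Its coefficient is the amount by which \<open>c x\<close> raises the maximum
      attained so far.\<close>
    define K where "K = Max (insert 0 (c ` S))"
    define e where "e = d(x := max 0 (c x - K))"
    have "Max (insert 0 (c ` {y\<in>insert x S. \<bar>y\<bar> \<le> t})) =
        (\<Sum>y\<in>insert x S. e y * (if \<bar>y\<bar> \<le> t then 1 else 0))" for t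
    proof -
      have sum: "(\<Sum>y\<in>insert x S. e y * (if \<bar>y\<bar> \<le> t then 1 else 0)) =
          max 0 (c x - K) * (if \<bar>x\<bar> \<le> t then 1 else 0) + Max (insert 0 (c ` {x\<in>S. \<bar>x\<bar> \<le> t}))"
        unfolding d(2) using False insert.hyps(1)
        by (auto simp: e_def intro!: sum.cong)
      show ?thesis
      proof (cases "\<bar>x\<bar> \<le> t")
        case True
        then have *: "{y\<in>insert x S. \<bar>y\<bar> \<le> t} = insert x S" "{y\<in>S. \<bar>y\<bar> \<le> t} = S"
          using insert.hyps(2) by force+
        have "Max (insert 0 (insert (c x) (c ` S))) = max (c x) K"
          unfolding K_def insert_commute[of 0] using insert.hyps(1)
          by (subst Max_insert) auto
        then show ?thesis
          unfolding sum * using True by (simp add: K_def[symmetric])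
      next
        case False
        then have "{y\<in>insert x S. \<bar>y\<bar> \<le> t} = {y\<in>S. \<bar>y\<bar> \<le> t}"
          by auto
        then show ?thesis unfolding sum using False by simp
      qed
    qed
    moreover have "\<forall>y. 0 \<le> e y" using d(1) by (simp add: e_def)
    ultimately show ?thesis by blast
  qed
qed

text \<open>Applied below in two ways: with \<open>Q x\<close> the event of hitting x, which yields
  point masses, and with \<open>Q x\<close> the event of reaching the radius
  \<open>\<bar>x\<bar>\<close>, which yields tails.\<close>

lemma (in prob_space) expectation_step:
  assumes "finite W" "\<And>x. x \<in> W \<Longrightarrow> {\<omega>\<in>space M. Q x \<omega>} \<in> events"
  shows "integrable M (\<lambda>\<omega>. \<Sum>x\<in>W. d x * (if Q x \<omega> then 1 else 0) :: real)"
    and "expectation (\<lambda>\<omega>. \<Sum>x\<in>W. d x * (if Q x \<omega> then 1 else 0) :: real) =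
      (\<Sum>x\<in>W. d x * prob {\<omega>\<in>space M. Q x \<omega>})"
proof -
  have int: "integrable M (\<lambda>\<omega>. if Q x \<omega> then 1 else 0 :: real)"
    and exp: "expectation (\<lambda>\<omega>. if Q x \<omega> then 1 else 0 :: real) = prob {\<omega>\<in>space M. Q x \<omega>}"
    if "x \<in> W" for x
  proof -
    have cong: "indicator {\<omega>\<in>space M. Q x \<omega>} \<omega> = (if Q x \<omega> then 1 else 0 :: real)"
      if "\<omega> \<in> space M" for \<omega>
      using that by (simp add: indicator_def)
    have "integrable M (indicator {\<omega>\<in>space M. Q x \<omega>} :: _ \<Rightarrow> real)"
      using assms(2)[OF that] by (simp add: less_top[symmetric])
    then show "integrable M (\<lambda>\<omega>. if Q x \<omega> then 1 else 0 :: real)"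
      using cong by (subst Bochner_Integration.integrable_cong[OF refl]) auto
    have "expectation (\<lambda>\<omega>. if Q x \<omega> then 1 else 0 :: real) =
        expectation (indicator {\<omega>\<in>space M. Q x \<omega>})"
      by (rule Bochner_Integration.integral_cong[OF refl]) (simp add: cong)
    then show "expectation (\<lambda>\<omega>. if Q x \<omega> then 1 else 0 :: real) = prob {\<omega>\<in>space M. Q x \<omega>}"
      using assms(2)[OF that] by (simp add: sets.Int_space_eq2)
  qed
  show "integrable M (\<lambda>\<omega>. \<Sum>x\<in>W. d x * (if Q x \<omega> then 1 else 0) :: real)"
    using int by (intro Bochner_Integration.integrable_sum integrable_mult_right) auto
  show "expectation (\<lambda>\<omega>. \<Sum>x\<in>W. d x * (if Q x \<omega> then 1 else 0) :: real) =
      (\<Sum>x\<in>W. d x * prob {\<omega>\<in>space M. Q x \<omega>})"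
    using int exp by (subst Bochner_Integration.integral_sum) auto
qed

section \<open>Tail functions and their quantiles\<close>

lemma tail_bounds_antimono:
  assumes "g \<in> tail_bounds" "t \<le> u"
  shows "g u \<le> g t"
proof (cases "t < 0")
  case True
  then show ?thesis using assms by (cases "u < 0") (auto simp: tail_bounds_def)
next
  case False
  then show ?thesis using assms by (auto simp: tail_bounds_def monotone_on_def)
qed

lemma tail_bounds_range:
  assumes "g \<in> tail_bounds"
  shows "0 \<le> g t" "g t \<le> 1"
  using assms by (cases "t < 0"; auto simp: tail_bounds_def)+

text \<open>The Galois connection between a tail and its generalised inverse. The limit 0 bounds the
  superlevel set, left continuity puts its supremum into it, and monotonicity makes it downward
  closed.\<close>

lemma shift_tilde_ge_iff:
  assumes g: "g \<in> tail_bounds" and s: "0 < s" "s < 1"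
  shows "t \<le> shift_tilde g s \<longleftrightarrow> 1 - s \<le> g t"
proof -
  define B where "B = {t. 1 - s \<le> g t}"
  have B: "shift_tilde g s = Sup B"
    using tail_bounds_range[OF g] by (auto simp: shift_tilde_def B_def intro!: arg_cong[of _ _ Sup])
  have g0: "g 0 = 1" and lim: "(g \<longlongrightarrow> 0) at_top"
    and cont: "\<And>t. t > 0 \<Longrightarrow> continuous (at_left t) g"
    using g by (auto simp: tail_bounds_def)
  have "0 \<in> B" using s g0 by (simp add: B_def)
  have "eventually (\<lambda>t. g t < 1 - s) at_top"
    using order_tendstoD(2)[OF lim] s by simp
  then obtain N where N: "\<And>t. t \<ge> N \<Longrightarrow> g t < 1 - s"
    by (auto simp: eventually_at_top_linorder)
  have bdd: "bdd_above B"
  proof (rule bdd_aboveI[of _ N])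
    fix x assume "x \<in> B"
    then show "x \<le> N" using N[of x] by (cases "N \<le> x") (auto simp: B_def)
  qed
  \<comment> \<open>Left continuity is given at positive points only; at 0 the value
    \<open>g 0 = 1\<close> suffices.\<close>
  have "1 - s \<le> g (Sup B)"
  proof (cases "Sup B = 0")
    case True
    then show ?thesis using s g0 by simp
  next
    case False
    then have "Sup B > 0" using cSup_upper[OF \<open>0 \<in> B\<close> bdd] by simp
    from cont[OF this] have "(g \<longlongrightarrow> g (Sup B)) (at_left (Sup B))"
      by (simp add: continuous_within)
    moreover have "eventually (\<lambda>t. 1 - s \<le> g t) (at_left (Sup B))"
    proof (rule eventually_at_leftI[of "Sup B - 1"])
      fix t assume "t \<in> {Sup B - 1<..<Sup B}"
      then obtain u where "u \<in> B" "t < u"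
        using less_cSup_iff[of B t] \<open>0 \<in> B\<close> bdd by auto
      then show "1 - s \<le> g t"
        using tail_bounds_antimono[OF g, of t u] by (simp add: B_def)
    qed simp
    ultimately show ?thesis
      by (rule tendsto_lowerbound) simp
  qed
  moreover have "t \<le> Sup B" if "1 - s \<le> g t"
    using that by (intro cSup_upper[OF _ bdd]) (simp add: B_def)
  ultimately show ?thesis
    unfolding B using tail_bounds_antimono[OF g, of t "Sup B"] by linarith
qed

lemma shift_tilde_nonneg:
  assumes "g \<in> tail_bounds" "0 < s" "s < 1"
  shows "0 \<le> shift_tilde g s"
  using assms by (simp add: shift_tilde_ge_iff) (simp add: tail_bounds_def)

lemma shift_tilde_mono:
  assumes "g \<in> tail_bounds" "0 < s" "s \<le> t" "t < 1"
  shows "shift_tilde g s \<le> shift_tilde g t"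
proof -
  have "1 - s \<le> g (shift_tilde g s)"
    using shift_tilde_ge_iff[of g s "shift_tilde g s"] assms by simp
  then show ?thesis
    using assms by (simp add: shift_tilde_ge_iff)
qed

text \<open>By the Galois connection the event is \<open>1 - g t \<le> s\<close>, so
  \<open>shift_tilde g\<close> has exactly the largest tail that the bound allows.\<close>

lemma shift_tilde_tail:
  assumes "g \<in> tail_bounds"
  shows "measure unit_interval {s \<in> {0<..<1}. t \<le> shift_tilde g s} = g t"
proof -
  have "{s \<in> {0<..<1}. t \<le> shift_tilde g s} = {s \<in> {0<..<1}. 1 - g t \<le> s}"
    using shift_tilde_ge_iff[OF assms] by (auto simp: field_simps)
  \<comment> \<open>If \<open>g t = 1\<close>, the half-open interval would start at 0, which is
    outside the domain.\<close>
  also have "\<dots> = (if g t = 1 then {0<..<1} else {1 - g t..<1})"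
    using tail_bounds_range[OF assms, of t] by auto
  finally have eq: "{s \<in> {0<..<1}. t \<le> shift_tilde g s} =
      (if g t = 1 then {0<..<1} else {1 - g t..<1})" .
  have "(if g t = 1 then {0<..<1} else {1 - g t..<1}) \<subseteq> {0<..<1::real}"
    unfolding eq[symmetric] by auto
  then have "emeasure unit_interval (if g t = 1 then {0<..<1} else {1 - g t..<1}) = ennreal (g t)"
    using tail_bounds_range[OF assms, of t] by (subst emeasure_unit_interval) auto
  then show ?thesis
    unfolding eq using tail_bounds_range[OF assms, of t] by (simp add: measure_def)
qed

section \<open>Shifts to finite sets\<close>

text \<open>As 0 lies in A, the half-line in \<open>shift_radius\<close> ends at 0 and does not
  affect the supremum, which becomes a maximum over finitely many radii. The last conjunct is the
  sign rule: when both signs of the radius lie in A, the nonnegative one is taken.\<close>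

lemma shift_component_eq_iff:
  assumes A: "finite A" "0 \<in> A" and T: "0 \<le> shift_tilde g s"
  shows "shift_component g A s = y \<longleftrightarrow> y \<in> A \<and> \<bar>y\<bar> \<le> shift_tilde g s \<and>
    (\<forall>a\<in>A. \<bar>a\<bar> \<le> shift_tilde g s \<longrightarrow> \<bar>a\<bar> \<le> \<bar>y\<bar>) \<and> (y < 0 \<longrightarrow> - y \<notin> A)"
proof -
  define T where "T = shift_tilde g s"
  define R where "R = {u \<in> abs ` A. u \<le> T}"
  have R: "finite R" "0 \<in> R"
    using A T by (force simp: R_def T_def)+
  have Inf: "Inf (abs ` A) = 0"
    using A by (intro cInf_eq_minimum) force+
  have rad: "shift_radius g A s = Max R"
    unfolding shift_radius_def Inf T_def[symmetric]
  proof (rule cSup_eq_maximum)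
    show "Max R \<in> {u \<in> abs ` A \<union> {..0}. u \<le> T}"
      using Max_in[of R] R by (auto simp only: R_def)
    fix u assume u: "u \<in> {u \<in> abs ` A \<union> {..0}. u \<le> T}"
    show "u \<le> Max R"
    proof (cases "u \<in> abs ` A")
      case True
      then show ?thesis using u by (intro Max_ge[OF R(1)]) (simp add: R_def)
    next
      case False
      then show ?thesis using u Max_ge[OF R] by auto
    qed
  qed
  define m where "m = Max R"
  have "m \<in> R" "0 \<le> m"
    using Max_in[OF R(1)] R(2) Max_ge[OF R] unfolding m_def by blast+
  then obtain a where a: "a \<in> A" "\<bar>a\<bar> = m" "m \<le> T"
    by (auto simp: R_def)
  have max: "\<bar>b\<bar> \<le> m" if "b \<in> A" "\<bar>b\<bar> \<le> T" for b
    unfolding m_def using that by (intro Max_ge[OF R(1)]) (simp add: R_def)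
  have comp: "shift_component g A s = (if m \<in> A then m else - m)"
    using \<open>0 \<le> m\<close> by (simp add: shift_component_def rad m_def)
  have a_cases: "m \<in> A \<or> - m \<in> A"
    using a by (auto simp: abs_if split: if_splits)
  show ?thesis
    unfolding T_def[symmetric]
  proof
    assume "shift_component g A s = y"
    then have y: "y = (if m \<in> A then m else - m)"
      by (simp add: comp)
    then show "y \<in> A \<and> \<bar>y\<bar> \<le> T \<and> (\<forall>a\<in>A. \<bar>a\<bar> \<le> T \<longrightarrow> \<bar>a\<bar> \<le> \<bar>y\<bar>) \<and> (y < 0 \<longrightarrow> - y \<notin> A)"
      using a_cases a(3) \<open>0 \<le> m\<close> max by auto
  next
    assume y: "y \<in> A \<and> \<bar>y\<bar> \<le> T \<and> (\<forall>a\<in>A. \<bar>a\<bar> \<le> T \<longrightarrow> \<bar>a\<bar> \<le> \<bar>y\<bar>) \<and> (y < 0 \<longrightarrow> - y \<notin> A)"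
    then have "\<bar>y\<bar> = m"
      using a max[of y] by force
    then have "y = m \<or> y = - m" by linarith
    then show "shift_component g A s = y"
      using y \<open>0 \<le> m\<close> by (cases "m = 0") (auto simp: comp)
  qed
qed

text \<open>A larger quantile admits more points of A, so the largest admissible radius grows. The
  signed value need not.\<close>

lemma shift_component_abs_mono:
  assumes "g \<in> tail_bounds" "finite A" "0 \<in> A" "0 < s" "s \<le> t" "t < 1"
  shows "\<bar>shift_component g A s\<bar> \<le> \<bar>shift_component g A t\<bar>"
proof -
  have T: "0 \<le> shift_tilde g s" "0 \<le> shift_tilde g t"
    using assms by (auto intro!: shift_tilde_nonneg)
  show ?thesis
    using shift_component_eq_iff[OF assms(2,3) T(1), of "shift_component g A s"]
      shift_component_eq_iff[OF assms(2,3) T(2), of "shift_component g A t"]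
      shift_tilde_mono[of g s t] assms by fastforce
qed

text \<open>The absolute value is monotone, hence measurable, and the sign is recovered from it by
  testing membership in the finite set A.\<close>

lemma shift_component_measurable:
  assumes g: "g \<in> tail_bounds" and A: "finite A" "0 \<in> A"
  shows "shift_component g A \<in> borel_measurable unit_interval"
proof -
  let ?r = "\<lambda>s. \<bar>shift_component g A s\<bar>"
  have [measurable]: "?r \<in> borel_measurable unit_interval"
    by (intro mono_on_unit_interval_measurable mono_onI)
      (use shift_component_abs_mono[OF g A] in auto)
  have [measurable]: "A \<in> sets borel"
    using A by (simp add: finite_imp_closed)
  have "(\<lambda>s. if ?r s \<in> A then ?r s else - ?r s) \<in> borel_measurable unit_interval"
    by measurable
  moreover have "(if ?r s \<in> A then ?r s else - ?r s) = shift_component g A s"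
    if "s \<in> {0<..<1}" for s
    using shift_component_eq_iff[OF A, of g s "shift_component g A s"]
      shift_tilde_nonneg[OF g, of s] that by (auto simp: abs_if split: if_splits)
  ultimately show ?thesis
    by (subst measurable_cong[where g = "\<lambda>s. if ?r s \<in> A then ?r s else - ?r s"]) auto
qed

text \<open>The shifted value never exceeds \<open>shift_tilde g\<close> in absolute value, and the
  tail of the latter is g.\<close>

lemma shift_component_tail:
  assumes g: "g \<in> tail_bounds" and A: "finite A" "0 \<in> A"
  shows "measure unit_interval {s \<in> {0<..<1}. t \<le> \<bar>shift_component g A s\<bar>} \<le> g t"
proof -
  have [measurable]: "shift_tilde g \<in> borel_measurable unit_interval"
    by (intro mono_on_unit_interval_measurable mono_onI)
      (use shift_tilde_mono[OF g] in auto)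
  have "{s \<in> space unit_interval. t \<le> shift_tilde g s} \<in> sets unit_interval"
    by measurable
  moreover have "\<bar>shift_component g A s\<bar> \<le> shift_tilde g s" if "s \<in> {0<..<1}" for s
    using shift_component_eq_iff[OF A, of g s "shift_component g A s"]
      shift_tilde_nonneg[OF g, of s] that by auto
  ultimately show ?thesis
    unfolding shift_tilde_tail[OF g, of t, symmetric]
    by (intro unit_interval.finite_measure_mono) force+
qed

section \<open>Optimality of record points for one component\<close>

lemma shift_component_optimal:
  fixes c :: "real \<Rightarrow> real"
  assumes g: "g \<in> tail_bounds" and W: "finite W" "0 \<in> W" and c: "\<And>x. 0 \<le> c x"
  shows "\<exists>A\<subseteq>W. 0 \<in> A \<and> (\<forall>Y\<in>borel_measurable unit_interval.
    (\<forall>t\<ge>0. measure unit_interval {s \<in> {0<..<1}. t \<le> \<bar>Y s\<bar>} \<le> g t) \<longrightarrow>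
    (\<Sum>x\<in>W. c x * point_mass Y x) \<le> (\<Sum>x\<in>W. c x * point_mass (shift_component g A) x))"
proof -
  define M where "M t = Max (insert 0 (c ` {x\<in>W. \<bar>x\<bar> \<le> t}))" for t
  \<comment> \<open>The record points. If x and -x are both records, they have the same weight, so
    the sign rule of the shift loses nothing.\<close>
  define A where "A = {x\<in>W. c x = M \<bar>x\<bar>}"
  have fin: "finite (insert 0 (c ` {x\<in>W. \<bar>x\<bar> \<le> t}))" for t
    using W by simp
  have cM: "c x \<le> M t" if "x \<in> W" "\<bar>x\<bar> \<le> t" for x t
    unfolding M_def using that fin by (intro Max_ge) auto
  have M_mono: "M t \<le> M u" if "t \<le> u" for t u
    unfolding M_def using that fin by (intro Max_mono) auto
  have attained: "\<exists>x\<in>W. \<bar>x\<bar> \<le> t \<and> c x = M t" if "0 \<le> t" for t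
  proof -
    have "M t \<in> insert 0 (c ` {x\<in>W. \<bar>x\<bar> \<le> t})"
      unfolding M_def by (rule Max_in[OF fin]) simp
    \<comment> \<open>If the maximum is the inserted default 0, then \<open>c 0\<close> is squeezed
      to 0 and the point 0 attains it.\<close>
    moreover have "\<exists>x\<in>W. \<bar>x\<bar> \<le> t \<and> c x = M t" if "M t = 0"
      using cM[of 0 t] c[of 0] W that \<open>0 \<le> t\<close> by force
    ultimately show ?thesis by auto
  qed
  have A: "A \<subseteq> W" "0 \<in> A" "finite A"
    using attained[of 0] W by (auto simp: A_def)
  obtain d where d: "\<forall>x. 0 \<le> d x"
    "\<And>t. M t = (\<Sum>x\<in>W. d x * (if \<bar>x\<bar> \<le> t then 1 else 0))"
    unfolding M_def using envelope_decomposition[OF W(1), of c] by blast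
  have point_ev: "{s \<in> space unit_interval. Y s = x} \<in> sets unit_interval"
    if [measurable]: "Y \<in> borel_measurable unit_interval" for Y and x :: real
    by measurable
  have tail_ev: "{s \<in> space unit_interval. t \<le> Y s} \<in> sets unit_interval"
    if [measurable]: "Y \<in> borel_measurable unit_interval" for Y and t :: real
    by measurable
  have pm: "(\<Sum>x\<in>W. c x * point_mass Y x) =
      (\<integral>s. (\<Sum>x\<in>W. c x * (if Y s = x then 1 else 0)) \<partial>unit_interval)"
    and pm_int: "integrable unit_interval (\<lambda>s. \<Sum>x\<in>W. c x * (if Y s = x then 1 else 0))"
    if "Y \<in> borel_measurable unit_interval" for Y
    using unit_interval.expectation_step[where d = c and Q = "\<lambda>x s. Y s = x", OF W(1)]
      point_ev[OF that] by (simp_all add: point_mass_def)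
  have tl: "(\<Sum>x\<in>W. d x * measure unit_interval {s \<in> {0<..<1}. \<bar>x\<bar> \<le> Y s}) =
      (\<integral>s. M (Y s) \<partial>unit_interval)"
    and tl_int: "integrable unit_interval (\<lambda>s. M (Y s))"
    if "Y \<in> borel_measurable unit_interval" for Y
    unfolding d(2)
    using unit_interval.expectation_step[where d = d and Q = "\<lambda>x s. \<bar>x\<bar> \<le> Y s", OF W(1)]
      tail_ev[OF that] by simp_all
  have cY: "(\<Sum>x\<in>W. c x * (if y = x then 1 else 0)) = (if y \<in> W then c y else 0)" for y
    using W(1) by (simp add: if_distrib cong: if_cong)
  have "(\<Sum>x\<in>W. c x * point_mass Y x) \<le> (\<Sum>x\<in>W. c x * point_mass (shift_component g A) x)"
    if Y [measurable]: "Y \<in> borel_measurable unit_interval"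
      and tail: "\<And>t. 0 \<le> t \<Longrightarrow> measure unit_interval {s \<in> {0<..<1}. t \<le> \<bar>Y s\<bar>} \<le> g t" for Y
  proof -
    have aY: "(\<lambda>s. \<bar>Y s\<bar>) \<in> borel_measurable unit_interval"
      by measurable
    have T: "shift_tilde g \<in> borel_measurable unit_interval"
      by (intro mono_on_unit_interval_measurable mono_onI)
        (use shift_tilde_mono[OF g] in auto)
    have S: "shift_component g A \<in> borel_measurable unit_interval"
      by (rule shift_component_measurable[OF g A(3,2)])
    have M0: "0 \<le> M t" for t
      unfolding M_def using fin by (intro Max_ge) auto
    have "(\<Sum>x\<in>W. c x * point_mass Y x) \<le> (\<integral>s. M \<bar>Y s\<bar> \<partial>unit_interval)"
      unfolding pm[OF Y]
    proof (rule integral_mono[OF pm_int[OF Y] tl_int[OF aY]])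
      fix s
      show "(\<Sum>x\<in>W. c x * (if Y s = x then 1 else 0)) \<le> M \<bar>Y s\<bar>"
        unfolding cY using cM[of "Y s" "\<bar>Y s\<bar>"] M0 by simp
    qed
    \<comment> \<open>The tail bound is used at the finitely many radii
      \<open>\<bar>x\<bar>\<close>; nonnegativity of \<open>d\<close> preserves the
      inequality.\<close>
    also have "\<dots> \<le> (\<Sum>x\<in>W. d x * g \<bar>x\<bar>)"
      unfolding tl[OF aY, symmetric] using d(1) tail
      by (intro sum_mono mult_left_mono) auto
    also have "\<dots> = (\<integral>s. M (shift_tilde g s) \<partial>unit_interval)"
      unfolding tl[OF T, symmetric] shift_tilde_tail[OF g] by simp
    also have "\<dots> = (\<Sum>x\<in>W. c x * point_mass (shift_component g A) x)"
      unfolding pm[OF S] cY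
    proof (rule Bochner_Integration.integral_cong[OF refl])
      fix s assume "s \<in> space unit_interval"
      then have t0: "0 \<le> shift_tilde g s"
        using shift_tilde_nonneg[OF g] by simp
      define y where "y = shift_component g A s"
      have y: "y \<in> A" "\<bar>y\<bar> \<le> shift_tilde g s"
        "\<And>a. a \<in> A \<Longrightarrow> \<bar>a\<bar> \<le> shift_tilde g s \<Longrightarrow> \<bar>a\<bar> \<le> \<bar>y\<bar>"
        using shift_component_eq_iff[OF A(3,2) t0, of y] by (auto simp: y_def)
      \<comment> \<open>A point that attains M at the quantile is itself a record, so the shifted
        value y is at least as far from 0. Hence M takes the same value at
        \<open>\<bar>y\<bar>\<close> as at the quantile, and y, being a record, has that
        weight.\<close>
      obtain x where x: "x \<in> W" "\<bar>x\<bar> \<le> shift_tilde g s" "c x = M (shift_tilde g s)"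
        using attained[OF t0] by blast
      have "c x = M \<bar>x\<bar>"
        using cM[of x "\<bar>x\<bar>"] M_mono[OF x(2)] x by simp
      then have "\<bar>x\<bar> \<le> \<bar>y\<bar>"
        using x y(3) by (simp add: A_def)
      then have "M (shift_tilde g s) \<le> M \<bar>y\<bar>"
        using M_mono[of "\<bar>x\<bar>" "\<bar>y\<bar>"] \<open>c x = M \<bar>x\<bar>\<close> x(3) by simp
      then show "M (shift_tilde g s) =
          (if shift_component g A s \<in> W then c (shift_component g A s) else 0)"
        using M_mono[OF y(2)] y(1) by (simp add: A_def y_def)
    qed
    finally show ?thesis .
  qed
  with A show ?thesis by blast
qed

text \<open>Deleting a point other than the selected one leaves the selected one maximal;
  \<open>x \<noteq> 0\<close> keeps 0 in the set. This is what permits pruning a maximiser.\<close>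

lemma shift_component_remove:
  assumes "finite A" "0 \<in> A" "0 \<le> shift_tilde g s" "x \<noteq> 0" "shift_component g A s \<noteq> x"
  shows "shift_component g (A - {x}) s = shift_component g A s"
  using assms shift_component_eq_iff[of A g s "shift_component g A s"]
  by (subst shift_component_eq_iff) auto

section \<open>Replacing components by shifts\<close>

lemma replace_component:
  fixes Z :: "'n::finite \<Rightarrow> real \<Rightarrow> real" and V :: "(real ^ 'n) set"
  assumes g: "g \<in> tail_bounds" and V: "finite V"
    and Z: "Z j \<in> borel_measurable unit_interval"
    and tail: "\<And>t. 0 \<le> t \<Longrightarrow> measure unit_interval {s \<in> {0<..<1}. t \<le> \<bar>Z j s\<bar>} \<le> g t"
  obtains A where "0 \<in> A" "A \<subseteq> insert 0 ((\<lambda>v. v $ j) ` V)"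
    "(\<Sum>v\<in>V. \<Prod>k\<in>UNIV. point_mass (Z k) (v $ k)) \<le>
     (\<Sum>v\<in>V. \<Prod>k\<in>UNIV. point_mass ((Z(j := shift_component g A)) k) (v $ k))"
proof -
  define W where "W = insert 0 ((\<lambda>v. v $ j) ` V)"
  \<comment> \<open>Grouping V by the j-th coordinate exhibits the probability as linear in the law
    of component j; \<open>c x\<close> collects the factors of the other components.\<close>
  define c where "c x = (\<Sum>v\<in>{v\<in>V. v $ j = x}. \<Prod>k\<in>UNIV - {j}. point_mass (Z k) (v $ k))" for x
  have W: "finite W" "0 \<in> W" using V by (auto simp: W_def)
  have c: "0 \<le> c x" for x
    by (auto simp: c_def point_mass_def intro!: sum_nonneg prod_nonneg)
  have eq: "(\<Sum>v\<in>V. \<Prod>k\<in>UNIV. point_mass ((Z(j := Y)) k) (v $ k)) = (\<Sum>x\<in>W. c x * point_mass Y x)"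
    for Y
  proof -
    have "(\<Prod>k\<in>UNIV. point_mass ((Z(j := Y)) k) (v $ k)) =
        (\<Prod>k\<in>UNIV - {j}. point_mass (Z k) (v $ k)) * point_mass Y (v $ j)" for v
      by (subst prod.remove[of _ j]) (auto simp: mult.commute intro!: prod.cong)
    then have "(\<Sum>v\<in>V. \<Prod>k\<in>UNIV. point_mass ((Z(j := Y)) k) (v $ k)) =
        (\<Sum>v\<in>V. (\<Prod>k\<in>UNIV - {j}. point_mass (Z k) (v $ k)) * point_mass Y (v $ j))"
      by simp
    also have "\<dots> = (\<Sum>x\<in>W. \<Sum>v\<in>{v\<in>V. v $ j = x}.
        (\<Prod>k\<in>UNIV - {j}. point_mass (Z k) (v $ k)) * point_mass Y (v $ j))"
      by (rule sum.group[symmetric, OF V W(1)]) (auto simp: W_def)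
    also have "\<dots> = (\<Sum>x\<in>W. c x * point_mass Y x)"
      unfolding c_def sum_distrib_right by (auto intro!: sum.cong)
    finally show ?thesis .
  qed
  obtain A where A: "A \<subseteq> W" "0 \<in> A"
    and le: "\<forall>Y\<in>borel_measurable unit_interval.
      (\<forall>t\<ge>0. measure unit_interval {s \<in> {0<..<1}. t \<le> \<bar>Y s\<bar>} \<le> g t) \<longrightarrow>
      (\<Sum>x\<in>W. c x * point_mass Y x) \<le> (\<Sum>x\<in>W. c x * point_mass (shift_component g A) x)"
    using shift_component_optimal[where c = c, OF g W c] by auto
  \<comment> \<open>The trivial update \<open>Z(j := Z j)\<close> lets \<open>eq\<close> rewrite
    both sides.\<close>
  have "(\<Sum>v\<in>V. \<Prod>k\<in>UNIV. point_mass ((Z(j := Z j)) k) (v $ k)) \<le>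
     (\<Sum>v\<in>V. \<Prod>k\<in>UNIV. point_mass ((Z(j := shift_component g A)) k) (v $ k))"
    unfolding eq using le Z tail by blast
  with A show thesis
    by (intro that[of A]) (auto simp: W_def)
qed

text \<open>Induction on the set of components already replaced. A component outside this set is
  still the original one, so its tail bound is available at its turn.\<close>

lemma replace_components:
  fixes Y :: "'n::finite \<Rightarrow> real \<Rightarrow> real" and V :: "(real ^ 'n) set"
  assumes f: "\<And>k. f k \<in> tail_bounds" and V: "finite V"
    and Y: "\<And>k. Y k \<in> borel_measurable unit_interval"
    and tail: "\<And>k t. 0 \<le> t \<Longrightarrow> measure unit_interval {s \<in> {0<..<1}. t \<le> \<bar>Y k s\<bar>} \<le> f k t"
  shows "\<exists>H. (\<forall>k. 0 \<in> H k \<and> H k \<subseteq> insert 0 ((\<lambda>v. v $ k) ` V)) \<and>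
    (\<Sum>v\<in>V. \<Prod>k\<in>UNIV. point_mass (Y k) (v $ k)) \<le>
    (\<Sum>v\<in>V. \<Prod>k\<in>UNIV. point_mass (shift_component (f k) (H k)) (v $ k))"
proof -
  have "\<exists>H. (\<forall>k. 0 \<in> H k \<and> H k \<subseteq> insert 0 ((\<lambda>v. v $ k) ` V)) \<and>
    (\<Sum>v\<in>V. \<Prod>k\<in>UNIV. point_mass (Y k) (v $ k)) \<le>
    (\<Sum>v\<in>V. \<Prod>k\<in>UNIV. point_mass (if k \<in> K then shift_component (f k) (H k) else Y k) (v $ k))"
    (is "\<exists>H. ?P K H") if "finite K" for K
    using that
  proof (induction K)
    case empty
    \<comment> \<open>The value \<open>{0}\<close> is a placeholder, overwritten when a component is
      replaced.\<close>
    show ?case by (intro exI[of _ "\<lambda>_. {0}"]) auto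
  next
    case (insert j K)
    then obtain H where H: "?P K H" by blast
    define Z where "Z k = (if k \<in> K then shift_component (f k) (H k) else Y k)" for k
    have Zj: "Z j = Y j" using insert by (simp add: Z_def)
    obtain A where A: "0 \<in> A" "A \<subseteq> insert 0 ((\<lambda>v. v $ j) ` V)"
      "(\<Sum>v\<in>V. \<Prod>k\<in>UNIV. point_mass (Z k) (v $ k)) \<le>
       (\<Sum>v\<in>V. \<Prod>k\<in>UNIV. point_mass ((Z(j := shift_component (f j) A)) k) (v $ k))"
      by (rule replace_component[OF f[of j] V, of Z j]) (use Y[of j] tail[of _ j] in \<open>auto simp: Zj\<close>)
    have Z: "Z(j := shift_component (f j) A) =
        (\<lambda>k. if k \<in> insert j K then shift_component (f k) ((H(j := A)) k) else Y k)"
      by (auto simp: Z_def fun_eq_iff)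
    have "?P (insert j K) (H(j := A))"
      using H A(1,2) order_trans[OF conjunct2[OF H, folded Z_def] A(3)[unfolded Z]] by auto
    then show ?case by blast
  qed
  from this[of UNIV] show ?thesis by simp
qed

section \<open>Monotone rearrangement\<close>

text \<open>Shifts may fail to be monotone, as they can take negative values, so they need not lie in
  \<^term>\<open>tail_class\<close>; their quantile functions do.\<close>

lemma monotone_rearrangement:
  assumes [measurable]: "Y \<in> borel_measurable unit_interval"
  shows "\<exists>Z :: real \<Rightarrow> real. mono_on {0<..<1} Z \<and>
    (\<forall>B\<in>sets borel. measure unit_interval {s \<in> {0<..<1}. Z s \<in> B} =
      measure unit_interval {s \<in> {0<..<1}. Y s \<in> B})"
proof -
  interpret D: cdf_distribution "distr unit_interval borel Y"
    unfolding cdf_distribution_def by (rule unit_interval.real_distribution_distr) measurable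
  have mono: "mono_on {0<..<1} D.I"
    by (rule D.mono_I)
  have [measurable]: "D.I \<in> borel_measurable unit_interval"
    by (rule mono_on_unit_interval_measurable[OF mono])
  \<comment> \<open>The quantile function \<open>D.I\<close> carries Lebesgue measure on (0,1) to
    the law of Y.\<close>
  have distr: "distr unit_interval borel D.I = distr unit_interval borel Y"
    using D.distr_I_eq_M by (simp add: unit_interval_def)
  have "measure unit_interval {s \<in> {0<..<1}. D.I s \<in> B} =
      measure unit_interval {s \<in> {0<..<1}. Y s \<in> B}" if [measurable]: "B \<in> sets borel" for B
  proof -
    have *: "measure (distr unit_interval borel Z) B = measure unit_interval {s \<in> {0<..<1}. Z s \<in> B}"
      if "Z \<in> borel_measurable unit_interval" for Z
      using that \<open>B \<in> sets borel\<close>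
      by (simp add: measure_distr vimage_def Int_def conj_commute)
    show ?thesis
      using *[of D.I] *[of Y] distr by simp
  qed
  with mono show ?thesis by blast
qed

section \<open>The maximum over finitely many shifts and a minimal maximiser\<close>

theorem theorem4p6p5:
  fixes f :: "'n::finite \<Rightarrow> real \<Rightarrow> real" and V :: "(real ^ 'n) set"
  assumes "\<forall>k. f k \<in> tail_bounds"
    and "finite V"
  shows "\<exists>(G :: (real ^ 'n) set) (H :: 'n \<Rightarrow> real set).
    G = product_set H \<and> G \<in> sets borel \<and> (\<forall>k. H k \<in> sets borel) \<and>
    0 \<in> G \<and> (\<forall>k. closed (abs ` H k)) \<and>
    (SUP X\<in>tail_class f. measure cube_measure {s \<in> unit_cube. X s \<in> V}) =
      measure cube_measure {s \<in> unit_cube. absolute_shift f H s \<in> V} \<and>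
    G = product_set (\<lambda>k. (\<lambda>x. x $ k) ` (G \<inter> V) \<union> {0})"
proof -
  have f: "f k \<in> tail_bounds" for k
    using assms(1) by blast
  interpret cube: prob_space "cube_measure :: (real ^ 'n) measure"
    by (rule prob_space_cube_measure)
  define W where "W k = insert 0 ((\<lambda>v. v $ k) ` V)" for k
  \<comment> \<open>The finitely many candidates to which \<open>replace_components\<close> reduces
    the problem.\<close>
  define \<H> where "\<H> = {H. \<forall>k. 0 \<in> H k \<and> H k \<subseteq> W k}"
  define \<Phi> where "\<Phi> H = measure cube_measure {s \<in> unit_cube. absolute_shift f H s \<in> V}" for H
  have finW: "finite (W k)" for k
    using assms(2) by (simp add: W_def)
  have finH: "finite (H k)" "0 \<in> H k" if "H \<in> \<H>" for H k
    using that finite_subset[OF _ finW[of k]] by (auto simp: \<H>_def)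
  have "\<H> \<subseteq> PiE UNIV (\<lambda>k. Pow (W k))"
    by (simp add: \<H>_def PiE_def Pi_def subset_eq)
  moreover have "finite (PiE UNIV (\<lambda>k. Pow (W k)))"
    by (rule finite_PiE) (simp_all add: finW)
  ultimately have fin\<H>: "finite \<H>"
    by (rule finite_subset)
  have "(\<lambda>k. {0}) \<in> \<H>"
    by (simp add: \<H>_def W_def)
  have S: "shift_component (f k) (H k) \<in> borel_measurable unit_interval" if "H \<in> \<H>" for H k
    by (rule shift_component_measurable[OF f finH[OF that]])
  have \<Phi>_ev: "{s \<in> unit_cube. absolute_shift f H s \<in> V} \<in> cube.events"
    and \<Phi>_eq: "\<Phi> H = (\<Sum>v\<in>V. \<Prod>k\<in>UNIV. point_mass (shift_component (f k) (H k)) (v $ k))"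
    if "H \<in> \<H>" for H
    using product_prob_finite[where Y = "\<lambda>k. shift_component (f k) (H k)"
        and X = "absolute_shift f H", OF S[OF that] _ assms(2)]
    by (simp_all add: \<Phi>_def absolute_shift_def)

  have upper: "\<exists>H\<in>\<H>. measure cube_measure {s \<in> unit_cube. X s \<in> V} \<le> \<Phi> H"
    if X: "X \<in> tail_class f" for X
  proof -
    obtain Y where Y: "\<And>k. mono_on {0<..<1} (Y k)" "\<forall>s\<in>unit_cube. X s = (\<chi> k. Y k (s $ k))"
      using X by (auto simp: tail_class_def neat_products_def neat_def)
    have m: "Y k \<in> borel_measurable unit_interval" for k
      by (rule mono_on_unit_interval_measurable[OF Y(1)])
    have tail: "measure unit_interval {s \<in> {0<..<1}. t \<le> \<bar>Y k s\<bar>} \<le> f k t" if "0 \<le> t" for k t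
    proof -
      have "measure cube_measure {s \<in> unit_cube. t \<le> \<bar>X s $ k\<bar>} \<le> f k t"
        using X that unfolding tail_class_def by blast
      then show ?thesis
        unfolding product_prob_component[where Y = Y and X = X and t = t and j = k, OF m Y(2)] .
    qed
    have "\<exists>H. (\<forall>k. 0 \<in> H k \<and> H k \<subseteq> W k) \<and>
      (\<Sum>v\<in>V. \<Prod>k\<in>UNIV. point_mass (Y k) (v $ k)) \<le>
      (\<Sum>v\<in>V. \<Prod>k\<in>UNIV. point_mass (shift_component (f k) (H k)) (v $ k))"
      unfolding W_def by (rule replace_components[OF f assms(2) m tail])
    then obtain H where H: "H \<in> \<H>"
      and le: "(\<Sum>v\<in>V. \<Prod>k\<in>UNIV. point_mass (Y k) (v $ k)) \<le>
        (\<Sum>v\<in>V. \<Prod>k\<in>UNIV. point_mass (shift_component (f k) (H k)) (v $ k))"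
      unfolding \<H>_def by blast
    have "measure cube_measure {s \<in> unit_cube. X s \<in> V} \<le> \<Phi> H"
      unfolding \<Phi>_eq[OF H] product_prob_finite(2)[where Y = Y and X = X, OF m Y(2) assms(2)]
      by (rule le)
    with H show ?thesis by blast
  qed

  \<comment> \<open>A member of \<open>tail_class f\<close> is needed here. Rearranging each
    component of the shift monotonically keeps its law, hence both the probability of V and the tail
    bounds.\<close>
  have attained: "\<exists>X\<in>tail_class f. measure cube_measure {s \<in> unit_cube. X s \<in> V} = \<Phi> H"
    if H: "H \<in> \<H>" for H
  proof -
    define rearr where "rearr k Z \<longleftrightarrow> mono_on {0<..<1} Z \<and>
      (\<forall>B\<in>sets borel. measure unit_interval {s \<in> {0<..<1}. Z s \<in> B} =
        measure unit_interval {s \<in> {0<..<1}. shift_component (f k) (H k) s \<in> B})"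
      for k and Z :: "real \<Rightarrow> real"
    have "\<exists>Z. rearr k Z" for k
      unfolding rearr_def by (rule monotone_rearrangement[OF S[OF H]])
    then obtain Z where rearr: "\<And>k. rearr k (Z k)"
      by metis
    have mono: "mono_on {0<..<1} (Z k)"
      and Z: "B \<in> sets borel \<Longrightarrow> measure unit_interval {s \<in> {0<..<1}. Z k s \<in> B} =
        measure unit_interval {s \<in> {0<..<1}. shift_component (f k) (H k) s \<in> B}" for k B
      using rearr[of k] by (simp_all only: rearr_def)
    define X where "X s = (\<chi> k. Z k (s $ k))" for s :: "real ^ 'n"
    have m: "Z k \<in> borel_measurable unit_interval" for k
      by (rule mono_on_unit_interval_measurable[OF mono])
    have X: "\<forall>s\<in>unit_cube. X s = (\<chi> k. Z k (s $ k))"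
      by (simp add: X_def)
    have "point_mass (Z k) x = point_mass (shift_component (f k) (H k)) x" for k x
      using Z[of "{x}" k] by (simp add: point_mass_def)
    then have val: "measure cube_measure {s \<in> unit_cube. X s \<in> V} = \<Phi> H"
      unfolding \<Phi>_eq[OF H] product_prob_finite(2)[where Y = Z and X = X, OF m X assms(2)] by simp
    have "measure cube_measure {s \<in> unit_cube. t \<le> \<bar>X s $ k\<bar>} \<le> f k t" for k t
    proof -
      have "{y :: real. t \<le> \<bar>y\<bar>} \<in> sets borel" by measurable
      from Z[of "{y. t \<le> \<bar>y\<bar>}" k, OF this] show ?thesis
        unfolding product_prob_component[where Y = Z and X = X and j = k and t = t, OF m X]
        using shift_component_tail[of "f k" "H k" t, OF f finH[OF H]] by simp
    qed
    moreover have "X \<in> neat_products"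
      unfolding neat_products_def neat_def using mono X by blast
    ultimately have "X \<in> tail_class f"
      unfolding tail_class_def by blast
    with val show ?thesis by blast
  qed

  obtain Hm where Hm: "Hm \<in> \<H>" "\<And>H. H \<in> \<H> \<Longrightarrow> \<Phi> H \<le> \<Phi> Hm"
    using obtains_MAX[OF fin\<H>, of \<Phi>] \<open>(\<lambda>k. {0}) \<in> \<H>\<close>
    by (metis Max_ge empty_iff finite_imageI fin\<H> imageI)
  \<comment> \<open>Two stages: \<open>Hm\<close> fixes the maximal value, and H minimises total
    cardinality among all families that reach it.\<close>
  obtain H where H: "H \<in> \<H>" "\<And>H'. H' \<in> \<H> \<Longrightarrow> \<Phi> H' \<le> \<Phi> H"
    and min: "\<And>H'. \<lbrakk>H' \<in> \<H>; \<Phi> H \<le> \<Phi> H'\<rbrakk> \<Longrightarrow> (\<Sum>k\<in>UNIV. card (H k)) \<le> (\<Sum>k\<in>UNIV. card (H' k))"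
  proof -
    obtain H where "H \<in> \<H> \<and> \<Phi> Hm \<le> \<Phi> H"
      "\<And>H'. H' \<in> \<H> \<and> \<Phi> Hm \<le> \<Phi> H' \<Longrightarrow> (\<Sum>k\<in>UNIV. card (H k)) \<le> (\<Sum>k\<in>UNIV. card (H' k))"
      using ex_has_least_nat[of "\<lambda>H. H \<in> \<H> \<and> \<Phi> Hm \<le> \<Phi> H" Hm "\<lambda>H. \<Sum>k\<in>UNIV. card (H k)"] Hm(1)
      by auto
    then show thesis
      using Hm(2) by (intro that[of H]) (blast intro: order_trans)+
  qed
  define G where "G = product_set H"
  have covered: "x \<in> (\<lambda>v. v $ j) ` (G \<inter> V)" if x: "x \<in> H j" "x \<noteq> 0" for x j
  proof (rule ccontr)
    assume nx: "x \<notin> (\<lambda>v. v $ j) ` (G \<inter> V)"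
    define H' where "H' = H(j := H j - {x})"
    have H': "H' \<in> \<H>"
      using H(1) x by (auto simp: H'_def \<H>_def)
    \<comment> \<open>On the event for H the shift lies in both G and V, so its j-th coordinate is
      never x. Dropping x therefore leaves the shift unchanged there, and the event for H is
      contained in that for \<open>H'\<close>.\<close>
    have "\<Phi> H \<le> \<Phi> H'"
      unfolding \<Phi>_def
    proof (rule cube.finite_measure_mono[OF _ \<Phi>_ev[OF H']], safe)
      fix s :: "real ^ 'n" assume s: "s \<in> unit_cube" "absolute_shift f H s \<in> V"
      have T: "0 \<le> shift_tilde (f k) (s $ k)" for k
        using s(1) by (auto simp: unit_cube_def intro!: shift_tilde_nonneg f)
      have "shift_component (f k) (H k) (s $ k) \<in> H k" for k
        using shift_component_eq_iff[OF finH[OF H(1)] T] by blast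
      then have "absolute_shift f H s \<in> G \<inter> V"
        using s(2) by (simp add: G_def product_set_def absolute_shift_def)
      then have "shift_component (f j) (H j) (s $ j) \<noteq> x"
        using nx by (force simp: absolute_shift_def)
      then have "shift_component (f k) (H' k) (s $ k) = shift_component (f k) (H k) (s $ k)" for k
        using shift_component_remove[OF finH[OF H(1)] T x(2)] by (simp add: H'_def)
      then have "absolute_shift f H' s = absolute_shift f H s"
        by (simp add: absolute_shift_def)
      then show "absolute_shift f H' s \<in> V" using s(2) by simp
    qed
    from min[OF H' this] have "(\<Sum>k\<in>UNIV. card (H k)) \<le> (\<Sum>k\<in>UNIV. card (H' k))" .
    moreover have "(\<Sum>k\<in>UNIV. card (H' k)) < (\<Sum>k\<in>UNIV. card (H k))"
    proof (rule sum_strict_mono_ex1)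
      show "\<forall>k\<in>UNIV. card (H' k) \<le> card (H k)"
        using finH(1)[OF H(1)] by (auto simp: H'_def intro!: card_mono)
      have "card (H' j) < card (H j)"
        unfolding H'_def fun_upd_same by (rule card_Diff1_less[OF finH(1)[OF H(1)] x(1)])
      then show "\<exists>k\<in>UNIV. card (H' k) < card (H k)" by blast
    qed simp
    ultimately show False by simp
  qed
  have "H k = (\<lambda>x. x $ k) ` (G \<inter> V) \<union> {0}" for k
  proof
    show "H k \<subseteq> (\<lambda>x. x $ k) ` (G \<inter> V) \<union> {0}"
      using covered by blast
    show "(\<lambda>x. x $ k) ` (G \<inter> V) \<union> {0} \<subseteq> H k"
      using finH(2)[OF H(1)] unfolding G_def product_set_def by blast
  qed
  then have "product_set H = product_set (\<lambda>k. (\<lambda>x. x $ k) ` (G \<inter> V) \<union> {0})"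
    by (intro arg_cong[where f = product_set] ext)
  then have G: "G = product_set (\<lambda>k. (\<lambda>x. x $ k) ` (G \<inter> V) \<union> {0})"
    by (simp only: G_def)
  have bor [measurable]: "H k \<in> sets borel" for k
    using finH(1)[OF H(1), of k] by (simp add: finite_imp_closed)
  have G_borel: "G \<in> sets borel"
    unfolding G_def product_set_def by measurable
  have zero: "0 \<in> G"
    using finH(2)[OF H(1)] by (simp add: G_def product_set_def)
  have closed: "closed (abs ` H k)" for k
    using finH(1)[OF H(1), of k] by (simp add: finite_imp_closed)
  have sup: "(SUP X\<in>tail_class f. measure cube_measure {s \<in> unit_cube. X s \<in> V}) = \<Phi> H"
  proof (rule cSup_eq_maximum)
    obtain X where X: "X \<in> tail_class f" "measure cube_measure {s \<in> unit_cube. X s \<in> V} = \<Phi> H"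
      using attained[OF H(1)] by blast
    show "\<Phi> H \<in> (\<lambda>X. measure cube_measure {s \<in> unit_cube. X s \<in> V}) ` tail_class f"
      by (rule image_eqI[where x = X]) (simp_all only: X)
  next
    fix p assume "p \<in> (\<lambda>X. measure cube_measure {s \<in> unit_cube. X s \<in> V}) ` tail_class f"
    then obtain X where X: "X \<in> tail_class f" "p = measure cube_measure {s \<in> unit_cube. X s \<in> V}"
      by (rule imageE)
    obtain H' where H': "H' \<in> \<H>" "p \<le> \<Phi> H'"
      using upper[OF X(1)] X(2) by blast
    show "p \<le> \<Phi> H"
      using H'(2) H(2)[OF H'(1)] by (rule order_trans)
  qed
  show ?thesis
    by (intro exI[of _ G] exI[of _ H] conjI allI G_def bor G_borel zero closed
        sup[unfolded \<Phi>_def] G)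
qed

end
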